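(* Let $d\ge 1$, let $\mathbf{n}=(n_1,\ldots,n_d)$ be a $d$-tuple of positive integers, and let $s$ be a positive integer. Let $\Sigma^1_{\mathbf{n},s}$ denote the sum (componentwise) of all tensors in $\mathcal{T}^1_{\mathbf{n},s}$. Then for each $\mathbf{x}\in \Pi_{\mathbf{n}}$, \[ \Sigma^{1}_{\mathbf{n},s}[\mathbf{x}] = \sum_{k=0}^{\min\{\omega(\mathbf{n},\mathbf{x}), \: s-1\}} \binom{|\mathbf{n}| - d + s - k}{s-k-1} \cdot [t^k] \, A_{\mathbf{x}-\mathbf 1}(t) A_{\mathbf{n} - \mathbf{x}}(t), \] where $\omega(\mathbf{n},\mathbf{x}) = |\mathbf{n}| - \max(\mathbf{x}) - \max(\mathbf{n}-\mathbf{x}) - d + 1$ and $[t^k]$ denotes the coefficient of $t^k$.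
   Context: $\Pi_{\mathbf{n}}=[n_1]\times\cdots\times[n_d]$ (where $[m]=\{1,\ldots,m\}$) with the product order: $\mathbf a\le\mathbf b$ iff $a_i\le b_i$ for all $i$. For a tuple $\mathbf{y}$, $|\mathbf y|=\sum_i y_i$, $\max(\mathbf y)=\max_i y_i$, $\mathbf 1=(1,\ldots,1)$, and subtraction is componentwise. A tensor $T\in\mathbb{R}^{n_1}\otimes\cdots\otimes\mathbb{R}^{n_d}$ is identified with its array of components $T[\mathbf{x}]$, $\mathbf{x}\in\Pi_{\mathbf{n}}$; $T$ has width one if its support $\{\mathbf{x}:T[\mathbf{x}]\ne0\}$ is a chain of $\Pi_{\mathbf{n}}$. $\mathcal{T}^1_{\mathbf{n},s}$ is the set of width-one tensors with nonnegative integer components summing to $s$. For a tuple $\mathbf p=(p_1,\ldots,p_d)$ of nonnegative integers, $\mathfrak S_{\mathbf p}$ is the set of words of length $|\mathbf p|$ in which each letter $i\in[d]$ appears exactly $p_i$ times; a descent of a word $\pi$ is an index $i$ with $\pi_i>\pi_{i+1}$, and the multiset Eulerian polynomial is $A_{\mathbf p}(t)=\sum_{\pi\in\mathfrak S_{\mathbf p}}t^{\mathrm{des}(\pi)}$, where $\mathrm{des}(\pi)$ is the number of descents of $\pi$. *)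

theory Defs
  imports Complex_Main "HOL-Computational_Algebra.Polynomial"
begin

text \<open>A tuple is a list, with the one-based entry $y_{i+1}$ stored at the list index \<open>i\<close>;
  its \<open>d\<close> is its length.\<close>

definition index_set :: "nat list \<Rightarrow> nat list set" where
  "index_set n = listset (map (\<lambda>m. {1..m}) n)"

definition prod_le :: "nat list \<Rightarrow> nat list \<Rightarrow> bool" where
  "prod_le a b \<longleftrightarrow> list_all2 (\<le>) a b"

definition tuple_diff :: "nat list \<Rightarrow> nat list \<Rightarrow> nat list" where
  "tuple_diff a b = map2 (-) a b"

definition tuple_max :: "nat list \<Rightarrow> nat" where
  "tuple_max y = Max (set y)"

text \<open>A tensor is its array of components, extended by zero outside the index set so that
  distinct functions are distinct tensors.\<close>

type_synonym tensor = "nat list \<Rightarrow> real"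

definition tensors :: "nat list \<Rightarrow> tensor set" where
  "tensors n = {T. \<forall>x. x \<notin> index_set n \<longrightarrow> T x = 0}"

definition support :: "nat list \<Rightarrow> tensor \<Rightarrow> nat list set" where
  "support n T = {x \<in> index_set n. T x \<noteq> 0}"

definition width_one :: "nat list \<Rightarrow> tensor \<Rightarrow> bool" where
  "width_one n T \<longleftrightarrow> Complete_Partial_Order.chain prod_le (support n T)"

definition width_one_tensors :: "nat list \<Rightarrow> nat \<Rightarrow> tensor set" where
  "width_one_tensors n s =
     {T \<in> tensors n. width_one n T \<and> (\<forall>x\<in>index_set n. T x \<in> \<nat>) \<and>
        (\<Sum>x\<in>index_set n. T x) = real s}"

definition width_one_sum :: "nat list \<Rightarrow> nat \<Rightarrow> tensor" where
  "width_one_sum n s = (\<lambda>x. \<Sum>T\<in>width_one_tensors n s. T x)"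

definition multiset_words :: "nat list \<Rightarrow> nat list set" where
  "multiset_words p =
     {w. length w = sum_list p \<and> set w \<subseteq> {1..length p} \<and>
         (\<forall>i<length p. count_list w (Suc i) = p ! i)}"

definition des :: "nat list \<Rightarrow> nat" where
  "des w = card {i. Suc i < length w \<and> w ! i > w ! Suc i}"

definition eulerian_poly :: "nat list \<Rightarrow> int poly" where
  "eulerian_poly p = (\<Sum>w\<in>multiset_words p. monom 1 (des w))"

text \<open>Integer-valued, because the partial differences can be negative
  (for \<open>d = 1\<close>, truncated subtraction would give 1 instead of 0).\<close>

definition omega :: "nat list \<Rightarrow> nat list \<Rightarrow> int" where
  "omega n x = int (sum_list n) - int (tuple_max x) - int (tuple_max (tuple_diff n x))
     - int (length n) + 1"

end

theory Submission
  imports Defs "HOL-Library.Multiset" "HOL-Library.List_Lexorder"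
    "HOL-Computational_Algebra.Polynomial_FPS"
begin

text \<open>A width-one tensor with component sum \<open>s\<close> is a multichain of length \<open>s\<close>, and its entry at \<open>x\<close>
  counts the positions of \<open>x\<close> in it. Cutting at such a position writes the sum at \<open>x\<close> as the
  convolution, over \<open>i + j = s - 1\<close>, of the numbers of multichains of length \<open>i\<close> below \<open>x\<close> and of
  length \<open>j\<close> above \<open>x\<close>. The numbers \<open>Z(m, p)\<close> of multichains of length \<open>m\<close> in the box \<open>[0, p]\<close>
  satisfy \<open>Z(m + 1, p) = (\<Sum>q\<le>p. Z(m, q))\<close>. So do the numbers of words of content \<open>p\<close> whose letters
  carry weakly increasing labels in \<open>{0..m}\<close>, strictly increasing at descents: the letters with the
  top label form a sorted suffix. Hence the generating function of \<open>Z(m, p)\<close> in \<open>m\<close> is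
  \<open>A\<^sub>p(t) / (1 - t)^(|p| + 1)\<close>, and the theorem reads off the coefficient of \<open>t^(s - 1)\<close> in a
  product of two such series. The cut-off at \<open>\<omega>\<close> is the degree bound
  \<open>deg A\<^sub>p \<le> |p| - max p\<close>.\<close>

subsection \<open>The product order\<close>

lemma prod_le_iff: "prod_le a b \<longleftrightarrow> length a = length b \<and> (\<forall>i<length b. a ! i \<le> b ! i)"
  by (auto simp: prod_le_def list_all2_conv_all_nth)

lemma prod_le_trans: "prod_le a b \<Longrightarrow> prod_le b c \<Longrightarrow> prod_le a c"
  by (auto simp: prod_le_iff intro: order_trans)

lemma prod_le_refl: "prod_le a a"
  by (simp add: prod_le_iff)

lemma finite_prod_le: "finite {q. prod_le q p}"
proof (rule finite_subset)
  show "{q. prod_le q p} \<subseteq> {q. set q \<subseteq> {..sum_list p} \<and> length q = length p}"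
  proof (auto simp: prod_le_iff in_set_conv_nth)
    fix q i assume "length q = length p" "\<forall>i<length p. q ! i \<le> p ! i" "i < length p"
    then show "q ! i \<le> sum_list p"
      using elem_le_sum_list[of i p] order_trans by blast
  qed
qed (simp add: finite_lists_length_eq)

lemma length_tuple_diff [simp]: "length (tuple_diff a b) = min (length a) (length b)"
  by (simp add: tuple_diff_def)

lemma nth_tuple_diff [simp]:
  "i < length a \<Longrightarrow> i < length b \<Longrightarrow> tuple_diff a b ! i = a ! i - b ! i"
  by (simp add: tuple_diff_def)

lemma sum_list_tuple_diff:
  assumes "prod_le b a"
  shows "sum_list (tuple_diff a b) + sum_list b = sum_list a"
  using assms unfolding prod_le_def
  by (induction rule: list_all2_induct) (auto simp: tuple_diff_def)

lemma index_set_iff: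
  "y \<in> index_set n \<longleftrightarrow> length y = length n \<and> (\<forall>i<length n. 1 \<le> y ! i \<and> y ! i \<le> n ! i)"
proof (induction n arbitrary: y)
  case Nil
  then show ?case by (auto simp: index_set_def)
next
  case (Cons a n)
  show ?case
  proof (cases y)
    case Nil
    then show ?thesis by (auto simp: index_set_def set_Cons_def)
  next
    case (Cons b z)
    have "y \<in> index_set (a # n) \<longleftrightarrow> b \<in> {1..a} \<and> z \<in> index_set n"
      using Cons by (auto simp: index_set_def set_Cons_def)
    then show ?thesis
      using Cons by (auto simp: Cons.IH All_less_Suc2)
  qed
qed

lemma finite_index_set: "finite (index_set n)"
  by (rule finite_subset[OF _ finite_prod_le[of n]]) (auto simp: index_set_iff prod_le_iff)

text \<open>The lexicographic order is a linear extension of the product order. Hence a multichain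
  is the lexicographically sorted list of its elements, and lists represent multichains without
  repetition.\<close>

lemma prod_le_imp_lex_le: "prod_le a b \<Longrightarrow> a \<le> b"
  unfolding prod_le_def by (induction rule: list_all2_induct) auto

section \<open>Multichains below and above a point\<close>

text \<open>The number of multichains of length \<open>m\<close> in the box from the zero tuple to
  \<open>p\<close>; the recursion sums over the top element \<open>q\<close>.\<close>

primrec multichain_count :: "nat \<Rightarrow> nat list \<Rightarrow> nat" where
  "multichain_count 0 p = 1"
| "multichain_count (Suc m) p = (\<Sum>q | prod_le q p. multichain_count m q)"

text \<open>The point \<open>y\<close> only bounds the list: it is neither an entry of it nor
  counted in \<open>m\<close>.\<close>

definition chains_below :: "nat list set \<Rightarrow> nat \<Rightarrow> nat list \<Rightarrow> nat list list set" where
  "chains_below S m y = {l. length l = m \<and> set l \<subseteq> S \<and> sorted_wrt prod_le (l @ [y])}"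

definition chains_above :: "nat list set \<Rightarrow> nat \<Rightarrow> nat list \<Rightarrow> nat list list set" where
  "chains_above S m y = {l. length l = m \<and> set l \<subseteq> S \<and> sorted_wrt prod_le (y # l)}"

lemma finite_chains_below: "finite S \<Longrightarrow> finite (chains_below S m y)"
  by (rule finite_subset[OF _ finite_lists_length_eq[of S m]]) (auto simp: chains_below_def)

lemma finite_chains_above: "finite S \<Longrightarrow> finite (chains_above S m y)"
  by (rule finite_subset[OF _ finite_lists_length_eq[of S m]]) (auto simp: chains_above_def)

text \<open>Classify by the last entry \<open>z\<close>. By transitivity, bounding the other entries
  by \<open>z\<close> also bounds them by \<open>y\<close>.\<close>

lemma card_chains_below_Suc:
  assumes "finite S"
  shows "card (chains_below S (Suc m) y) = (\<Sum>z | z \<in> S \<and> prod_le z y. card (chains_below S m z))"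
proof -
  have "chains_below S (Suc m) y
      = (\<Union>z\<in>{z \<in> S. prod_le z y}. (\<lambda>l. l @ [z]) ` chains_below S m z)" (is "?L = ?R")
  proof (intro equalityI subsetI)
    fix l assume "l \<in> ?L"
    then show "l \<in> ?R"
      by (cases l rule: rev_cases) (auto simp: chains_below_def sorted_wrt_append)
  next
    fix l assume "l \<in> ?R"
    then show "l \<in> ?L"
      by (auto simp: chains_below_def sorted_wrt_append intro: prod_le_trans)
  qed
  also have "card \<dots> = (\<Sum>z | z \<in> S \<and> prod_le z y. card ((\<lambda>l. l @ [z]) ` chains_below S m z))"
    using assms by (intro card_UN_disjoint) (auto simp: finite_chains_below)
  also have "\<dots> = (\<Sum>z | z \<in> S \<and> prod_le z y. card (chains_below S m z))"
    by (intro sum.cong refl card_image) (auto intro: inj_onI)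
  finally show ?thesis .
qed

lemma card_chains_above_Suc:
  assumes "finite S"
  shows "card (chains_above S (Suc m) y) = (\<Sum>z | z \<in> S \<and> prod_le y z. card (chains_above S m z))"
proof -
  have "chains_above S (Suc m) y
      = (\<Union>z\<in>{z \<in> S. prod_le y z}. (\<lambda>l. z # l) ` chains_above S m z)" (is "?L = ?R")
  proof (intro equalityI subsetI)
    fix l assume "l \<in> ?L"
    then show "l \<in> ?R"
      by (cases l) (auto simp: chains_above_def)
  next
    fix l assume "l \<in> ?R"
    then show "l \<in> ?L"
      by (auto simp: chains_above_def intro: prod_le_trans)
  qed
  also have "card \<dots> = (\<Sum>z | z \<in> S \<and> prod_le y z. card ((\<lambda>l. z # l) ` chains_above S m z))"
    using assms by (intro card_UN_disjoint) (auto simp: finite_chains_above)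
  also have "\<dots> = (\<Sum>z | z \<in> S \<and> prod_le y z. card (chains_above S m z))"
    by (intro sum.cong refl card_image) (auto intro: inj_onI)
  finally show ?thesis .
qed

lemma card_chains_0: "card (chains_below S 0 y) = 1" "card (chains_above S 0 y) = 1"
proof -
  have "chains_below S 0 y = {[]}" "chains_above S 0 y = {[]}"
    by (auto simp: chains_below_def chains_above_def)
  then show "card (chains_below S 0 y) = 1" "card (chains_above S 0 y) = 1" by simp_all
qed

text \<open>Subtracting 1 from every coordinate is an order isomorphism from the part of the index
  set below \<open>y\<close> onto a box based at zero, so both sides obey the same
  recursion.\<close>

lemma card_chains_below:
  assumes "y \<in> index_set n"
  shows "card (chains_below (index_set n) m y)
    = multichain_count m (tuple_diff y (replicate (length n) 1))"
  using assms
proof (induction m arbitrary: y)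
  case 0
  then show ?case by (simp add: card_chains_0)
next
  case (Suc m)
  let ?one = "replicate (length n) (1::nat)"
  have "card (chains_below (index_set n) (Suc m) y)
      = (\<Sum>z | z \<in> index_set n \<and> prod_le z y. multichain_count m (tuple_diff z ?one))"
    using Suc.IH by (simp add: card_chains_below_Suc finite_index_set)
  also have "\<dots> = (\<Sum>q | prod_le q (tuple_diff y ?one). multichain_count m q)"
  proof (rule sum.reindex_bij_witness[where i = "map Suc" and j = "\<lambda>z. tuple_diff z ?one"])
    fix z assume z: "z \<in> {z. z \<in> index_set n \<and> prod_le z y}"
    show "map Suc (tuple_diff z ?one) = z"
      using z by (intro nth_equalityI) (auto simp: index_set_iff)
    show "tuple_diff z ?one \<in> {q. prod_le q (tuple_diff y ?one)}"
      using z Suc.prems by (auto simp: index_set_iff prod_le_iff intro: diff_le_mono)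
  next
    fix q assume "q \<in> {q. prod_le q (tuple_diff y ?one)}"
    then have len: "length q = length n" and q: "\<And>i. i < length n \<Longrightarrow> q ! i \<le> y ! i - 1"
      using Suc.prems by (simp_all add: index_set_iff prod_le_iff)
    show "tuple_diff (map Suc q) ?one = q"
      using len by (intro nth_equalityI) simp_all
    \<comment> \<open>Entries of \<open>y\<close> are at least 1, so the truncated subtraction in
      the bound on \<open>q\<close> is exact.\<close>
    have "Suc (q ! i) \<le> y ! i" "y ! i \<le> n ! i" if "i < length n" for i
      using q[OF that] Suc.prems that by (simp_all add: index_set_iff) (use that in force)
    then show "map Suc q \<in> {z. z \<in> index_set n \<and> prod_le z y}"
      using len Suc.prems by (auto simp: index_set_iff prod_le_iff intro: order_trans)
  qed simp
  finally show ?case by simp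
qed

text \<open>The reflection \<open>z\<close> to \<open>n - z\<close> reverses the order and carries
  the part of the index set above \<open>y\<close> onto a box based at zero.\<close>

lemma card_chains_above:
  assumes "y \<in> index_set n"
  shows "card (chains_above (index_set n) m y) = multichain_count m (tuple_diff n y)"
  using assms
proof (induction m arbitrary: y)
  case 0
  then show ?case by (simp add: card_chains_0)
next
  case (Suc m)
  have "card (chains_above (index_set n) (Suc m) y)
      = (\<Sum>z | z \<in> index_set n \<and> prod_le y z. multichain_count m (tuple_diff n z))"
    using Suc.IH by (simp add: card_chains_above_Suc finite_index_set)
  also have "\<dots> = (\<Sum>q | prod_le q (tuple_diff n y). multichain_count m q)"
  proof (rule sum.reindex_bij_witness[where i = "tuple_diff n" and j = "tuple_diff n"])
    fix z assume z: "z \<in> {z. z \<in> index_set n \<and> prod_le y z}"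
    show "tuple_diff n (tuple_diff n z) = z"
      using z by (intro nth_equalityI) (auto simp: index_set_iff)
    show "tuple_diff n z \<in> {q. prod_le q (tuple_diff n y)}"
      using z Suc.prems by (auto simp: index_set_iff prod_le_iff intro: diff_le_mono2)
  next
    fix q assume "q \<in> {q. prod_le q (tuple_diff n y)}"
    then have len: "length q = length n" and q: "\<And>i. i < length n \<Longrightarrow> q ! i \<le> n ! i - y ! i"
      using Suc.prems by (simp_all add: index_set_iff prod_le_iff)
    have y: "1 \<le> y ! i" "y ! i \<le> n ! i" if "i < length n" for i
      using Suc.prems that by (simp_all add: index_set_iff)
    have qn: "q ! i \<le> n ! i" "y ! i \<le> n ! i - q ! i" if "i < length n" for i
      using q[OF that] y[OF that] by linarith+
    show "tuple_diff n (tuple_diff n q) = q"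
      using len qn by (intro nth_equalityI) simp_all
    have "1 \<le> n ! i - q ! i" if "i < length n" for i
      using qn(2)[OF that] y(1)[OF that] by linarith
    then show "tuple_diff n q \<in> {z. z \<in> index_set n \<and> prod_le y z}"
      using len qn Suc.prems by (simp add: index_set_iff prod_le_iff)
  qed simp
  finally show ?case by simp
qed

subsection \<open>Width-one tensors as multichains\<close>

definition multichains :: "nat list set \<Rightarrow> nat \<Rightarrow> nat list list set" where
  "multichains S s = {l. length l = s \<and> set l \<subseteq> S \<and> sorted_wrt prod_le l}"

lemma finite_multichains: "finite S \<Longrightarrow> finite (multichains S s)"
  by (rule finite_subset[OF _ finite_lists_length_eq[of S s]]) (auto simp: multichains_def)

lemma multichains_sorted: "l \<in> multichains S s \<Longrightarrow> sorted l"
  unfolding multichains_def by (auto elim!: sorted_wrt_mono_rel[rotated] intro: prod_le_imp_lex_le)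

lemma sorted_wrt_set_cases:
  "sorted_wrt P l \<Longrightarrow> a \<in> set l \<Longrightarrow> b \<in> set l \<Longrightarrow> a = b \<or> P a b \<or> P b a"
  by (induction l) auto

text \<open>A multichain goes to its multiplicity function. A sorted list is determined by its
  multiplicities, which gives injectivity; listing the support of a tensor with multiplicity in
  lexicographic order gives a preimage.\<close>

lemma bij_betw_multichains:
  "bij_betw (\<lambda>l y. real (count_list l y)) (multichains (index_set n) s) (width_one_tensors n s)"
proof (rule bij_betw_imageI)
  show "inj_on (\<lambda>l y. real (count_list l y)) (multichains (index_set n) s)"
  proof (rule inj_onI)
    fix k l
    assume k: "k \<in> multichains (index_set n) s" and l: "l \<in> multichains (index_set n) s"
      and "(\<lambda>y. real (count_list k y)) = (\<lambda>y. real (count_list l y))"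
    then have "count_list k y = count_list l y" for y
      by (metis of_nat_eq_iff)
    then have "mset k = mset l"
      by (intro multiset_eqI) (simp add: count_mset)
    then show "k = l"
      using multichains_sorted[OF k] multichains_sorted[OF l]
      by (metis sorted_list_of_multiset_mset sorted_sort_id)
  qed
  show "(\<lambda>l y. real (count_list l y)) ` multichains (index_set n) s = width_one_tensors n s"
  proof (intro equalityI subsetI)
    fix T assume "T \<in> (\<lambda>l y. real (count_list l y)) ` multichains (index_set n) s"
    then obtain l where l: "l \<in> multichains (index_set n) s"
      and T: "T = (\<lambda>y. real (count_list l y))" by blast
    have "T y = 0" if "y \<notin> index_set n" for y
      using l that by (auto simp: T multichains_def count_list_0_iff)
    moreover have "width_one n T"
      unfolding width_one_def chain_def
    proof (intro ballI)
      fix a b assume "a \<in> support n T" "b \<in> support n T"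
      then have "a \<in> set l" "b \<in> set l"
        by (auto simp: support_def T count_list_0_iff)
      then show "prod_le a b \<or> prod_le b a"
        using l sorted_wrt_set_cases[of prod_le l a b] by (auto simp: multichains_def prod_le_refl)
    qed
    moreover have "(\<Sum>y\<in>index_set n. T y) = real s"
      using l sum_count_set[of l "index_set n"] finite_index_set[of n]
      by (simp add: T multichains_def flip: of_nat_sum)
    ultimately show "T \<in> width_one_tensors n s"
      by (auto simp: width_one_tensors_def tensors_def T)
  next
    fix T assume T: "T \<in> width_one_tensors n s"
    define f where "f y = nat \<lfloor>T y\<rfloor>" for y
    have Tf: "T y = real (f y)" for y
    proof (cases "y \<in> index_set n")
      case True
      then have "T y \<in> \<nat>" using T by (auto simp: width_one_tensors_def)
      then show ?thesis by (auto simp: f_def elim!: Nats_cases)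
    next
      case False
      then show ?thesis using T by (auto simp: width_one_tensors_def tensors_def f_def)
    qed
    have f0: "f y = 0" if "y \<notin> index_set n" for y
      using T that Tf[of y] by (auto simp: width_one_tensors_def tensors_def)
    have "finite {y. 0 < f y}"
      by (rule finite_subset[OF _ finite_index_set[of n]]) (use f0 in force)
    then have count: "count (Abs_multiset f) = f"
      by (rule count_Abs_multiset)
    define l where "l = sorted_list_of_multiset (Abs_multiset f)"
    have mset_l: "mset l = Abs_multiset f"
      by (simp add: l_def)
    have cl: "count_list l y = f y" for y
      by (metis count mset_l count_mset)
    have set_l: "y \<in> set l \<longleftrightarrow> f y \<noteq> 0" for y
      by (metis cl count_list_0_iff)
    have sub: "set l \<subseteq> index_set n"
      using set_l f0 by blast
    have "sorted l" by (simp add: l_def)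
    have "sorted_wrt prod_le l"
    proof (rule sorted_wrt_mono_rel[OF _ \<open>sorted l\<close>])
      fix a b assume ab: "a \<in> set l" "b \<in> set l" and "a \<le> b"
      have "a \<in> support n T" "b \<in> support n T"
        using ab sub set_l by (auto simp: support_def Tf)
      then have "prod_le a b \<or> prod_le b a"
        using T by (auto simp: width_one_tensors_def width_one_def chain_def)
      \<comment> \<open>If \<open>prod_le b a\<close> holds, then also \<open>b \<le> a\<close>
        lexicographically, and antisymmetry gives \<open>a = b\<close>.\<close>
      then show "prod_le a b"
        using prod_le_imp_lex_le[of b a] \<open>a \<le> b\<close> prod_le_refl by force
    qed
    moreover have "length l = s"
    proof -
      have "length l = (\<Sum>y\<in>index_set n. f y)"
        using sum_count_set[OF sub finite_index_set] by (simp add: cl)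
      moreover have "(\<Sum>y\<in>index_set n. real (f y)) = real s"
        using T by (simp add: width_one_tensors_def Tf)
      ultimately show ?thesis by (simp flip: of_nat_sum)
    qed
    ultimately have "l \<in> multichains (index_set n) s"
      using sub by (simp add: multichains_def)
    moreover have "T = (\<lambda>y. real (count_list l y))"
      by (simp add: cl Tf fun_eq_iff)
    ultimately show "T \<in> (\<lambda>l y. real (count_list l y)) ` multichains (index_set n) s"
      by blast
  qed
qed

text \<open>The parts before and after position \<open>j\<close> can be chosen independently:
  transitivity through \<open>x\<close> makes every entry of the first comparable with every entry
  of the second.\<close>

lemma card_multichains_nth:
  assumes "j < s" "x \<in> S"
  shows "card {l \<in> multichains S s. l ! j = x}
    = card (chains_below S j x) * card (chains_above S (s - 1 - j) x)"
proof -
  have "bij_betw (\<lambda>(a, b). a @ x # b) (chains_below S j x \<times> chains_above S (s - 1 - j) x)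
      {l \<in> multichains S s. l ! j = x}"
  proof (rule bij_betw_byWitness[where f' = "\<lambda>l. (take j l, drop (Suc j) l)"])
    show "\<forall>a\<in>chains_below S j x \<times> chains_above S (s - 1 - j) x.
        (\<lambda>l. (take j l, drop (Suc j) l)) ((\<lambda>(a, b). a @ x # b) a) = a"
      by (auto simp: chains_below_def)
    show "\<forall>l\<in>{l \<in> multichains S s. l ! j = x}.
        (\<lambda>(a, b). a @ x # b) ((\<lambda>l. (take j l, drop (Suc j) l)) l) = l"
      using assms by (auto simp: multichains_def id_take_nth_drop[symmetric])
    show "(\<lambda>(a, b). a @ x # b) ` (chains_below S j x \<times> chains_above S (s - 1 - j) x)
        \<subseteq> {l \<in> multichains S s. l ! j = x}"
      using assms
      by (auto simp: multichains_def chains_below_def chains_above_def sorted_wrt_append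
            nth_append) (meson prod_le_trans)
    show "(\<lambda>l. (take j l, drop (Suc j) l)) ` {l \<in> multichains S s. l ! j = x}
        \<subseteq> chains_below S j x \<times> chains_above S (s - 1 - j) x"
    proof clarsimp
      fix l assume l: "l \<in> multichains S s" and x: "x = l ! j"
      have "l = take j l @ x # drop (Suc j) l"
        using l x assms by (simp add: multichains_def id_take_nth_drop[symmetric])
      then have "sorted_wrt prod_le (take j l @ x # drop (Suc j) l)"
        using l by (simp add: multichains_def)
      then show "take j l \<in> chains_below S j (l ! j) \<and>
          drop (Suc j) l \<in> chains_above S (s - Suc j) (l ! j)"
        using l assms x set_take_subset[of j l] set_drop_subset[of "Suc j" l]
        by (auto simp: multichains_def chains_below_def chains_above_def sorted_wrt_append)
    qed
  qed
  from bij_betw_same_card[OF this] show ?thesis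
    by (simp add: card_cartesian_product)
qed

text \<open>Evaluating the sum at \<open>x\<close> counts multichains with a marked occurrence of \<open>x\<close>;
  the mark splits the multichain into a part below and a part above \<open>x\<close>.\<close>

lemma width_one_sum_eq:
  assumes "x \<in> index_set n"
  shows "width_one_sum n s x = real (\<Sum>j<s. multichain_count j (tuple_diff x (replicate (length n) 1))
    * multichain_count (s - 1 - j) (tuple_diff n x))"
proof -
  let ?L = "multichains (index_set n) s"
  have fin: "finite ?L" by (simp add: finite_multichains finite_index_set)
  have "width_one_sum n s x = (\<Sum>l\<in>?L. real (count_list l x))"
    unfolding width_one_sum_def using bij_betw_multichains
    by (rule sum.reindex_bij_betw[symmetric])
  also have "\<dots> = real (\<Sum>l\<in>?L. count_list l x)" by simp
  also have "(\<Sum>l\<in>?L. count_list l x) = (\<Sum>l\<in>?L. \<Sum>j<s. if l ! j = x then 1 else 0)"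
  proof (rule sum.cong[OF refl])
    fix l assume "l \<in> ?L"
    then have "count_list l x = card {j. j < s \<and> l ! j = x}"
      by (auto simp: multichains_def count_list_eq_length_filter length_filter_conv_card
          intro!: arg_cong[where f = card])
    also have "{j. j < s \<and> l ! j = x} = {..<s} \<inter> {j. l ! j = x}" by auto
    finally show "count_list l x = (\<Sum>j<s. if l ! j = x then 1 else 0)"
      by (simp add: sum.If_cases)
  qed
  also have "\<dots> = (\<Sum>j<s. \<Sum>l\<in>?L. if l ! j = x then 1 else 0)"
    by (rule sum.swap)
  also have "\<dots> = (\<Sum>j<s. card {l \<in> ?L. l ! j = x})"
    using fin by (simp add: sum.If_cases Int_def)
  also have "\<dots> = (\<Sum>j<s. multichain_count j (tuple_diff x (replicate (length n) 1))
      * multichain_count (s - 1 - j) (tuple_diff n x))"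
    using assms by (simp add: card_multichains_nth card_chains_below card_chains_above)
  finally show ?thesis .
qed

subsection \<open>Words and descents\<close>

definition content :: "nat list \<Rightarrow> nat multiset" where
  "content p = (\<Sum>i<length p. replicate_mset (p ! i) (Suc i))"

lemma count_content: "count (content p) a = (if a \<in> {1..length p} then p ! (a - 1) else 0)"
proof -
  have "count (content p) a = (\<Sum>i<length p. if i = a - 1 \<and> a \<noteq> 0 then p ! i else 0)"
    unfolding content_def count_sum by (intro sum.cong) auto
  also have "\<dots> = (if a \<in> {1..length p} then p ! (a - 1) else 0)"
    by (cases a) auto
  finally show ?thesis .
qed

lemma size_content: "size (content p) = sum_list p"
  by (simp add: content_def sum_list_sum_nth atLeast0LessThan)

text \<open>Replaces the letter counts by one multiset equation, so that the content of a suffix is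
  obtained by subtracting that of the prefix.\<close>

lemma multiset_words_eq: "multiset_words p = {w. mset w = content p}"
proof (intro equalityI subsetI)
  fix w assume w: "w \<in> multiset_words p"
  have "count (mset w) a = count (content p) a" for a
  proof (cases "a \<in> {1..length p}")
    case True
    then obtain i where "a = Suc i" "i < length p" by (cases a) auto
    then show ?thesis using w by (simp add: multiset_words_def count_content count_mset)
  next
    case False
    then have "a \<notin> set w" using w by (auto simp: multiset_words_def)
    then show ?thesis using False by (auto simp: count_content count_mset)
  qed
  then show "w \<in> {w. mset w = content p}" by (simp add: multiset_eqI)
next
  fix w assume "w \<in> {w. mset w = content p}"
  then have w: "mset w = content p" by simp
  have "length w = sum_list p" by (metis w size_mset size_content)
  moreover have cl: "count_list w a = (if a \<in> {1..length p} then p ! (a - 1) else 0)" for a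
    by (metis w count_mset count_content)
  moreover have "set w \<subseteq> {1..length p}"
    using cl by (metis count_list_0_iff subsetI)
  ultimately show "w \<in> multiset_words p" by (simp add: multiset_words_def)
qed

lemma finite_multiset_words: "finite (multiset_words p)"
  by (rule finite_subset[OF _ finite_lists_length_eq[of "{1..length p}" "sum_list p"]])
     (auto simp: multiset_words_def)

lemma des_Nil [simp]: "des [] = 0"
  by (simp add: des_def)

lemma des_snoc: "des (u @ [c]) = des u + (if u \<noteq> [] \<and> last u > c then 1 else 0)"
proof (cases u rule: rev_cases)
  case Nil
  then show ?thesis by (simp add: des_def)
next
  case (snoc v b)
  have "{i. Suc i < length (u @ [c]) \<and> (u @ [c]) ! i > (u @ [c]) ! Suc i}
      = {i. Suc i < length u \<and> u ! i > u ! Suc i} \<union> (if b > c then {length v} else {})"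
    using snoc by (auto simp: nth_append less_Suc_eq split: if_splits)
  moreover have "finite {i. Suc i < length u \<and> u ! i > u ! Suc i}"
    by (rule finite_subset[of _ "{..<length u}"]) auto
  ultimately show ?thesis
    using snoc by (auto simp: des_def)
qed

lemma des_eq_0_iff: "des w = 0 \<longleftrightarrow> sorted w"
proof -
  have "finite {i. Suc i < length w \<and> w ! i > w ! Suc i}"
    by (rule finite_subset[of _ "{..<length w}"]) auto
  then show ?thesis
    by (auto simp: des_def sorted_iff_nth_Suc not_less) (metis leD)
qed

text \<open>The word splits into \<open>length w - des w\<close> maximal strictly decreasing runs,
  and each of them contains \<open>a\<close> at most once.\<close>

lemma des_add_count_list_le: "des w + count_list w a \<le> length w"
proof -
  text \<open>A final letter above \<open>a\<close> leaves one unit of slack, to be spent by a descent to \<open>a\<close>.\<close>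
  have "des w + count_list w a + (if w \<noteq> [] \<and> last w > a then 1 else 0) \<le> length w"
    by (induction w rule: rev_induct) (auto simp: des_snoc split: if_splits)
  then show ?thesis by linarith
qed

text \<open>The number of weakly increasing sequences in \<open>{0..m}\<close> indexed by the letters of \<open>w\<close> that
  increase strictly at each descent of \<open>w\<close>.\<close>

definition barred_count :: "nat \<Rightarrow> nat list \<Rightarrow> nat" where
  "barred_count m w =
     (if des w \<le> m then (length w + (m - des w)) choose length w else 0)"

text \<open>The last letter is labelled either at most \<open>m\<close> or exactly
  \<open>Suc m\<close>. In the second case a descent before \<open>c\<close> restricts the labels of
  \<open>u\<close> to at most \<open>m\<close>; otherwise they may reach
  \<open>Suc m\<close>.\<close>

lemma barred_count_snoc:
  "barred_count (Suc m) (u @ [c]) = barred_count m (u @ [c])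
    + (if u \<noteq> [] \<and> last u > c then barred_count m u else barred_count (Suc m) u)"
proof (cases "u \<noteq> [] \<and> last u > c")
  case True
  \<comment> \<open>The first case is Pascal's rule. In the boundary case \<open>des u = m\<close>
    the term \<open>barred_count m (u @ [c])\<close> vanishes and the other two are 1.\<close>
  consider "des u < m" | "des u = m" | "des u > m" by linarith
  then show ?thesis
  proof cases
    case 1
    then obtain e where "m = Suc (des u + e)" using less_iff_Suc_add by auto
    then show ?thesis using True by (simp add: barred_count_def des_snoc)
  qed (use True in \<open>simp_all add: barred_count_def des_snoc\<close>)
next
  case False
  then have des: "des (u @ [c]) = des u" by (auto simp: des_snoc)
  consider "des u \<le> m" | "des u = Suc m" | "des u > Suc m" by linarith
  then have "barred_count (Suc m) (u @ [c]) = barred_count m (u @ [c]) + barred_count (Suc m) u"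
  proof cases
    case 1
    then obtain e where "m = des u + e" using le_iff_add by auto
    then show ?thesis by (simp add: barred_count_def des)
  qed (simp_all add: barred_count_def des)
  then show ?thesis unfolding if_not_P[OF False] .
qed

text \<open>Splitting off the letters labelled by the largest value \<open>Suc m\<close>, which form a sorted suffix.\<close>

lemma barred_count_Suc:
  "barred_count (Suc m) w = (\<Sum>k | k \<le> length w \<and> sorted (drop k w). barred_count m (take k w))"
proof (induction w rule: rev_induct)
  case Nil
  have "{k. k \<le> length ([]::nat list) \<and> sorted (drop k ([]::nat list))} = {0}" by auto
  then show ?case by (simp add: barred_count_def)
next
  case (snoc c u)
  let ?K = "\<lambda>w::nat list. {k. k \<le> length w \<and> sorted (drop k w)}"
  let ?K' = "{k. k \<le> length u \<and> sorted (drop k u @ [c])}"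
  have "?K (u @ [c]) = insert (Suc (length u)) ?K'"
    by (auto simp: le_Suc_eq)
  moreover have "finite ?K'" by simp
  moreover have "Suc (length u) \<notin> ?K'" by simp
  ultimately have "(\<Sum>k\<in>?K (u @ [c]). barred_count m (take k (u @ [c])))
      = barred_count m (u @ [c]) + (\<Sum>k\<in>?K'. barred_count m (take k u))"
    by (simp del: drop_append)
  also have "(\<Sum>k\<in>?K'. barred_count m (take k u))
      = (if u \<noteq> [] \<and> last u > c then barred_count m u else barred_count (Suc m) u)"
  proof (cases "u \<noteq> [] \<and> last u > c")
    case True
    \<comment> \<open>A descent just before \<open>c\<close> leaves \<open>[c]\<close> as the only
      sorted suffix ending in \<open>c\<close>.\<close>
    have "k = length u" if k: "k \<in> ?K'" for k
    proof (rule ccontr)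
      assume "k \<noteq> length u"
      then have "k < length u" using k by simp
      then have "last u \<in> set (drop k u)"
        using last_in_set[of "drop k u"] by simp
      then show False using k True by (fastforce simp: sorted_append)
    qed
    then have "?K' = {length u}" by auto
    then show ?thesis using True by simp
  next
    case False
    \<comment> \<open>Without a descent before \<open>c\<close>, appending \<open>c\<close> keeps
      every sorted suffix sorted.\<close>
    have "\<forall>a\<in>set (drop k u). a \<le> c" if "sorted (drop k u)" "k \<le> length u" for k
    proof (cases "drop k u" rule: rev_cases)
      case (snoc v b)
      then have "u = (take k u @ v) @ [b]"
        by (metis append_assoc append_take_drop_id)
      then have "u \<noteq> []" "last u = b"
        by (metis snoc_eq_iff_butlast)+
      then show ?thesis using False snoc that by (auto simp: sorted_append)
    qed simp
    then have "?K' = ?K u" by (auto simp: sorted_append)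
    then show ?thesis using False snoc.IH by auto
  qed
  finally show ?case by (simp add: barred_count_snoc)
qed

text \<open>Both sides satisfy the same recursion in \<open>m\<close>: cutting off a sorted suffix
  leaves a word of some content \<open>q\<close> below \<open>p\<close>, and the suffix is recovered
  as the sorted list of the missing letters. For \<open>m = 0\<close> exactly one word, the sorted
  one, contributes.\<close>

lemma multichain_count_eq_sum_words:
  "multichain_count m p = (\<Sum>w\<in>multiset_words p. barred_count m w)"
proof (induction m arbitrary: p)
  case 0
  have "{w \<in> multiset_words p. sorted w} = {sorted_list_of_multiset (content p)}"
    by (auto simp: multiset_words_eq) (metis sorted_list_of_multiset_mset sorted_sort_id)
  moreover have "(\<Sum>w\<in>multiset_words p. barred_count 0 w)
      = (\<Sum>w\<in>multiset_words p. if sorted w then 1 else 0)"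
    by (intro sum.cong) (auto simp: barred_count_def des_eq_0_iff)
  ultimately show ?case
    by (simp add: sum.If_cases finite_multiset_words Int_def)
next
  case (Suc m)
  let ?W = multiset_words
  let ?K = "\<lambda>w::nat list. {k. k \<le> length w \<and> sorted (drop k w)}"
  \<comment> \<open>The content tuple of \<open>u\<close>; it recovers the component
    \<open>q\<close> of a pair \<open>(q, u)\<close> from \<open>u\<close> alone.\<close>
  let ?c = "\<lambda>u. map (\<lambda>i. count_list u (Suc i)) [0..<length p]"
  have W: "u \<in> ?W q \<Longrightarrow> prod_le q p \<Longrightarrow> mset u \<subseteq># content p \<and> q = ?c u" for q u
    by (auto simp: multiset_words_eq prod_le_iff count_content subseteq_mset_def
        intro!: nth_equalityI simp flip: count_mset)
  have C: "prod_le (?c u) p \<and> u \<in> ?W (?c u)" if "mset u \<subseteq># content p" for u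
  proof
    have le: "count (mset u) a \<le> count (content p) a" for a
      using that by (simp add: subseteq_mset_def)
    have "count_list u (Suc i) \<le> p ! i" if "i < length p" for i
      using le[of "Suc i"] that by (simp add: count_content count_mset)
    then show "prod_le (?c u) p"
      by (simp add: prod_le_iff)
    have "count (mset u) a = count (content (?c u)) a" for a
      using le[of a] by (auto simp: count_content count_mset)
    then show "u \<in> ?W (?c u)" by (simp add: multiset_words_eq multiset_eqI)
  qed
  have "multichain_count (Suc m) p = (\<Sum>q | prod_le q p. \<Sum>u\<in>?W q. barred_count m u)"
    by (simp add: Suc.IH)
  also have "\<dots> = (\<Sum>(q, u)\<in>Sigma {q. prod_le q p} ?W. barred_count m u)"
    by (rule sum.Sigma) (auto simp: finite_prod_le finite_multiset_words)
  also have "\<dots> = (\<Sum>(w, k)\<in>Sigma (?W p) ?K. barred_count m (take k w))"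
  proof (rule sum.reindex_bij_witness
      [where i = "\<lambda>(w, k). (?c (take k w), take k w)"
         and j = "\<lambda>(q, u). (u @ sorted_list_of_multiset (content p - mset u), length u)"])
    fix a assume "a \<in> Sigma {q. prod_le q p} ?W"
    then obtain q u where a: "a = (q, u)" and q: "prod_le q p" "u \<in> ?W q" by auto
    note W' = W[OF q(2,1)]
    show "(\<lambda>(w, k). (?c (take k w), take k w))
        ((\<lambda>(q, u). (u @ sorted_list_of_multiset (content p - mset u), length u)) a) = a"
      using W' by (simp add: a)
    show "(\<lambda>(q, u). (u @ sorted_list_of_multiset (content p - mset u), length u)) a
        \<in> Sigma (?W p) ?K"
      using W' by (simp add: a multiset_words_eq)
    show "(case (\<lambda>(q, u). (u @ sorted_list_of_multiset (content p - mset u), length u)) a of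
        (w, k) \<Rightarrow> barred_count m (take k w)) = (case a of (q, u) \<Rightarrow> barred_count m u)"
      by (simp add: a)
  next
    fix b assume "b \<in> Sigma (?W p) ?K"
    then obtain w k where b: "b = (w, k)" and w: "mset w = content p" "k \<le> length w"
      "sorted (drop k w)" by (auto simp: multiset_words_eq)
    have split: "content p = mset (take k w) + mset (drop k w)"
      by (metis w(1) append_take_drop_id mset_append)
    then show "(\<lambda>(w, k). (?c (take k w), take k w)) b \<in> Sigma {q. prod_le q p} ?W"
      using C[of "take k w"] by (simp add: b)
    have "sorted_list_of_multiset (content p - mset (take k w)) = drop k w"
      using w(3) by (simp add: split sorted_sort_id)
    then show "(\<lambda>(q, u). (u @ sorted_list_of_multiset (content p - mset u), length u))
        ((\<lambda>(w, k). (?c (take k w), take k w)) b) = b"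
      using w(2) by (simp add: b)
  qed
  also have "\<dots> = (\<Sum>w\<in>?W p. \<Sum>k\<in>?K w. barred_count m (take k w))"
    by (rule sum.Sigma[symmetric]) (auto simp: finite_multiset_words)
  also have "\<dots> = (\<Sum>w\<in>?W p. barred_count (Suc m) w)"
    by (simp add: barred_count_Suc)
  finally show ?case .
qed

subsection \<open>Generating functions\<close>

text \<open>The power series of \<open>1 / (1 - t)^(a + 1)\<close>.\<close>

definition choose_fps :: "nat \<Rightarrow> int fps" where
  "choose_fps a = Abs_fps (\<lambda>j. int ((a + j) choose a))"

text \<open>Multiplying by the geometric series takes partial sums of coefficients, which raises
  \<open>a\<close> by one by the hockey-stick identity. In this form products are computed by adding
  exponents.\<close>

lemma choose_fps_eq: "choose_fps a = Abs_fps (\<lambda>_. 1) ^ Suc a"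
proof (induction a)
  case 0
  then show ?case by (simp add: choose_fps_def)
next
  case (Suc a)
  have "choose_fps (Suc a) = choose_fps a * Abs_fps (\<lambda>_. 1)"
  proof (rule fps_ext)
    fix m
    show "fps_nth (choose_fps (Suc a)) m = fps_nth (choose_fps a * Abs_fps (\<lambda>_. 1)) m"
      using choose_rising_sum(1)[of a m]
      by (simp add: choose_fps_def fps_mult_nth atLeast0AtMost del: binomial_Suc_Suc
          flip: of_nat_sum)
  qed
  then show ?case using Suc by (simp add: mult.commute)
qed

lemma coeff_eulerian_poly:
  "coeff (eulerian_poly p) k = int (card {w \<in> multiset_words p. des w = k})"
  by (simp add: eulerian_poly_def coeff_sum sum.If_cases finite_multiset_words Int_def)

text \<open>A word with \<open>k\<close> descents contributes
  \<open>t^k / (1 - t)^(|p| + 1)\<close>, by the closed form of \<open>barred_count\<close>;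
  grouping words by \<open>k\<close> yields the Eulerian polynomial.\<close>

lemma multichain_fps:
  "Abs_fps (\<lambda>m. int (multichain_count m p)) = fps_of_poly (eulerian_poly p) * choose_fps (sum_list p)"
proof (rule fps_ext)
  fix m
  let ?W = "multiset_words p" and ?N = "sum_list p"
  have "int (multichain_count m p) = (\<Sum>w\<in>?W. \<Sum>k\<le>m. if des w = k then int ((?N + (m - k)) choose ?N) else 0)"
    unfolding multichain_count_eq_sum_words of_nat_sum
    by (intro sum.cong refl) (auto simp: barred_count_def multiset_words_def)
  also have "\<dots> = (\<Sum>k\<le>m. \<Sum>w\<in>?W. if des w = k then int ((?N + (m - k)) choose ?N) else 0)"
    by (rule sum.swap)
  also have "\<dots> = (\<Sum>k\<le>m. coeff (eulerian_poly p) k * int ((?N + (m - k)) choose ?N))"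
    by (simp add: sum.If_cases finite_multiset_words Int_def coeff_eulerian_poly)
  finally show "fps_nth (Abs_fps (\<lambda>m. int (multichain_count m p))) m
      = fps_nth (fps_of_poly (eulerian_poly p) * choose_fps ?N) m"
    by (simp add: choose_fps_def fps_mult_nth atLeast0AtMost)
qed

section \<open>Degree bounds and the cut-off at \<open>omega\<close>\<close>

lemma degree_eulerian_poly:
  assumes "i < length p"
  shows "degree (eulerian_poly p) + p ! i \<le> sum_list p"
proof -
  have "degree (eulerian_poly p) \<le> sum_list p - p ! i"
  proof (rule degree_le, intro allI impI)
    fix k assume "sum_list p - p ! i < k"
    moreover have "des w + p ! i \<le> sum_list p" if "w \<in> multiset_words p" for w
      using des_add_count_list_le[of w "Suc i"] that assms by (simp add: multiset_words_def)
    ultimately have "{w \<in> multiset_words p. des w = k} = {}" by fastforce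
    then show "coeff (eulerian_poly p) k = 0"
      by (simp only: coeff_eulerian_poly card.empty)
  qed
  then show ?thesis using elem_le_sum_list[OF assms] by linarith
qed

text \<open>Add the degree bounds for the two factors, each taken at a largest entry. The
  \<open>+ 1\<close> in \<open>omega\<close> arises because the largest entry of
  \<open>x - 1\<close> is \<open>tuple_max x - 1\<close>.\<close>

lemma degree_le_omega:
  assumes "x \<in> index_set n" "length n \<ge> 1"
  shows "int (degree (eulerian_poly (tuple_diff x (replicate (length n) 1)) *
           eulerian_poly (tuple_diff n x))) \<le> omega n x"
proof -
  let ?p = "tuple_diff x (replicate (length n) 1)" and ?q = "tuple_diff n x"
  have len: "length x = length n" "length ?q = length n"
    using assms by (auto simp: index_set_iff)
  have "tuple_max x \<in> set x" "tuple_max ?q \<in> set ?q"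
    unfolding tuple_max_def using assms len by (auto intro!: Max_in simp flip: length_greater_0_conv)
  then obtain i j where i: "i < length n" "tuple_max x = x ! i"
    and j: "j < length n" "tuple_max ?q = ?q ! j"
    using len by (metis in_set_conv_nth)
  have "degree (eulerian_poly ?p) + ?p ! i \<le> sum_list ?p"
    using i len by (intro degree_eulerian_poly) simp
  moreover have "degree (eulerian_poly ?q) + ?q ! j \<le> sum_list ?q"
    using j len by (intro degree_eulerian_poly) simp
  moreover have "sum_list ?p + length n = sum_list x"
    using sum_list_tuple_diff[of "replicate (length n) 1" x] assms
    by (simp add: prod_le_iff index_set_iff sum_list_replicate)
  moreover have "sum_list ?q + sum_list x = sum_list n"
    using sum_list_tuple_diff[of x n] assms by (simp add: prod_le_iff index_set_iff)
  moreover have "?p ! i + 1 = x ! i"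
    using i assms by (auto simp: index_set_iff)
  ultimately have "int (degree (eulerian_poly ?p) + degree (eulerian_poly ?q)) \<le> omega n x"
    unfolding omega_def i j by linarith
  then show ?thesis
    using degree_mult_le[of "eulerian_poly ?p" "eulerian_poly ?q"] by linarith
qed

theorem theorem6p1:
  fixes d s :: nat and n x :: "nat list"
  assumes "d \<ge> 1"
    and "length n = d"
    and "\<forall>i<d. n ! i > 0"
    and "s > 0"
    and "x \<in> index_set n"
  shows "width_one_sum n s x =
    (\<Sum>k | int k \<le> min (omega n x) (int s - 1).
       real ((sum_list n - d + s - k) choose (s - k - 1)) *
       of_int (coeff (eulerian_poly (tuple_diff x (replicate d 1)) *
                      eulerian_poly (tuple_diff n x)) k))"
proof -
  let ?p = "tuple_diff x (replicate d 1)" and ?q = "tuple_diff n x"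
  let ?A = "eulerian_poly ?p * eulerian_poly ?q" and ?N = "sum_list n - d"
  let ?b = "\<lambda>k. (?N + s - k) choose (s - k - 1)"
  have N: "sum_list ?p + sum_list ?q = ?N"
    using sum_list_tuple_diff[of "replicate d 1" x] sum_list_tuple_diff[of x n] assms
    by (simp add: prod_le_iff index_set_iff sum_list_replicate)
  \<comment> \<open>The exponents \<open>|p| + 1\<close> and \<open>|q| + 1\<close> add up to
    \<open>?N + 2\<close>, whence the index \<open>Suc ?N\<close>.\<close>
  have choose: "choose_fps (sum_list ?p) * choose_fps (sum_list ?q) = choose_fps (Suc ?N)"
    unfolding choose_fps_eq power_add[symmetric] N[symmetric] by simp
  have "int (\<Sum>j<s. multichain_count j ?p * multichain_count (s - 1 - j) ?q)
      = fps_nth (Abs_fps (\<lambda>m. int (multichain_count m ?p)) *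
          Abs_fps (\<lambda>m. int (multichain_count m ?q))) (s - 1)"
    unfolding fps_mult_nth using assms(4) by (auto simp: intro!: sum.cong)
  also have "\<dots> = fps_nth (fps_of_poly ?A * choose_fps (Suc ?N)) (s - 1)"
    unfolding multichain_fps by (simp add: fps_of_poly_mult choose[symmetric] mult_ac)
  also have "\<dots> = (\<Sum>k<s. coeff ?A k * int (?b k))"
    unfolding fps_mult_nth
  proof (rule sum.cong)
    fix k assume "k \<in> {..<s}"
    \<comment> \<open>Prepares the symmetry of binomial coefficients, which exchanges the lower
      index \<open>Suc ?N\<close> for \<open>s - k - 1\<close>.\<close>
    then have eq: "Suc ?N + (s - 1 - k) = ?N + s - k" "?N + s - k - Suc ?N = s - k - 1"
      "Suc ?N \<le> ?N + s - k" by auto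
    have "(Suc ?N + (s - 1 - k)) choose Suc ?N = ?b k"
      unfolding eq(1) binomial_symmetric[OF eq(3)] eq(2) ..
    then show "fps_nth (fps_of_poly ?A) k * fps_nth (choose_fps (Suc ?N)) (s - 1 - k)
        = coeff ?A k * int (?b k)"
      by (simp add: choose_fps_def del: binomial_Suc_Suc)
  qed (use assms(4) in auto)
  \<comment> \<open>Terms with \<open>k\<close> above \<open>omega n x\<close> vanish, as
    \<open>k\<close> then exceeds the degree of \<open>?A\<close>; the bound
    \<open>int s - 1\<close> restates \<open>k < s\<close>.\<close>
  also have "\<dots> = (\<Sum>k | int k \<le> min (omega n x) (int s - 1). coeff ?A k * int (?b k))"
  proof (rule sum.mono_neutral_right)
    show "\<forall>k\<in>{..<s} - {k. int k \<le> min (omega n x) (int s - 1)}. coeff ?A k * int (?b k) = 0"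
    proof
      fix k assume "k \<in> {..<s} - {k. int k \<le> min (omega n x) (int s - 1)}"
      then have "degree ?A < k"
        using degree_le_omega[OF assms(5)] assms(1,2) by auto
      then show "coeff ?A k * int (?b k) = 0" by (simp add: coeff_eq_0)
    qed
  qed auto
  finally have "real_of_int (int (\<Sum>j<s. multichain_count j ?p * multichain_count (s - 1 - j) ?q))
      = real_of_int (\<Sum>k | int k \<le> min (omega n x) (int s - 1). coeff ?A k * int (?b k))"
    by (rule arg_cong)
  then show ?thesis
    unfolding width_one_sum_eq[OF assms(5)] assms(2) by (simp add: mult.commute)
qed

end
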